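(* Let $\mathcal{H}_d$ be a $d$-dimensional complex Hilbert space and let $\Phi:B(\mathcal{H}_d)\to B(\mathcal{H}_d)$ be a KS-decomposable map, i.e. there exist a unital KS operator $\Phi_1$ and a unital co-KS operator $\Phi_2$ on $B(\mathcal{H}_d)$ such that $$\Phi=\lambda\Phi_1+(1-\lambda)\Phi_2$$ for some $\lambda\in[0,1]$. Then for all $x\in B(\mathcal{H}_d)$, $$\Phi(x^*\circ x)-\Phi(x)^*\circ\Phi(x)\;\ge\;\lambda(1-\lambda)\,\big(\Phi_1(x)-\Phi_2(x)\big)^*\circ\big(\Phi_1(x)-\Phi_2(x)\big),$$ where $A\circ B:=AB+BA$.
   Context: $B(\mathcal{H}_d)$ is the algebra of linear operators on $\mathcal{H}_d$; operator inequalities are in the positive semidefinite order. A unital linear map $\Psi:B(\mathcal{H}_d)\to B(\mathcal{H}_d)$ is a Kadison--Schwarz (KS) operator if $\Psi(X^*X)\ge\Psi(X)^*\Psi(X)$ for all $X\in B(\mathcal{H}_d)$, and a co-Kadison--Schwarz (co-KS) operator if $\Psi(X^*X)\ge\Psi(X)\Psi(X)^*$ for all $X\in B(\mathcal{H}_d)$. A unital positive linear map is KS-decomposable if it is a convex combination $\lambda\Phi_1+(1-\lambda)\Phi_2$, $\lambda\in[0,1]$, of a unital KS operator $\Phi_1$ and a unital co-KS operator $\Phi_2$. The Jordan product here carries no factor $1/2$. *)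

theory Defs
  imports "HOL-Analysis.Analysis"
begin

text \<open>
  The \<open>d\<close>-dimensional complex Hilbert space is \<^typ>\<open>complex^'n\<close> with \<open>d = CARD('n)\<close> and its
  standard inner product; its operators are the matrices \<^typ>\<open>complex^'n^'n\<close> with product
  \<^term>\<open>(**)\<close> and unit \<^term>\<open>mat 1\<close>.
\<close>

text \<open>
  The library inner product on \<^typ>\<open>complex^'n\<close> is the real part of this one.
\<close>
definition cinner_vec :: "complex^'n \<Rightarrow> complex^'n \<Rightarrow> complex" where
  "cinner_vec v w = (\<Sum>i\<in>UNIV. cnj (v $ i) * w $ i)"

definition adj :: "complex^'n^'n \<Rightarrow> complex^'n^'n" where
  "adj A = (\<chi> i j. cnj (A $ j $ i))"

text \<open>
  Requiring the quadratic form to be real (and not only to have nonnegative real part) makes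
  positive semidefinite matrices self-adjoint.
\<close>
definition psd :: "complex^'n^'n \<Rightarrow> bool" where
  "psd A \<longleftrightarrow> (\<forall>v. cinner_vec v (A *v v) \<in> \<real>\<^sub>\<ge>\<^sub>0)"

definition loewner_le :: "complex^'n^'n \<Rightarrow> complex^'n^'n \<Rightarrow> bool"  (infix "\<preceq>" 50) where
  "A \<preceq> B \<longleftrightarrow> psd (B - A)"

text \<open>No factor \<open>1/2\<close>.\<close>
definition jordan :: "complex^'n^'n \<Rightarrow> complex^'n^'n \<Rightarrow> complex^'n^'n"  (infixl "\<odot>" 70) where
  "A \<odot> B = A ** B + B ** A"

text \<open>
  The library class predicate \<^const>\<open>linear\<close> is only real linearity; complex linearity is
  taken with respect to this scalar multiplication.
\<close>
definition cscale :: "complex \<Rightarrow> complex^'n^'n \<Rightarrow> complex^'n^'n" where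
  "cscale c A = (\<chi> i j. c * A $ i $ j)"

lemma vector_space_cscale: "vector_space cscale"
  by unfold_locales (simp_all add: cscale_def vec_eq_iff algebra_simps)

definition unital_linear :: "(complex^'n^'n \<Rightarrow> complex^'n^'n) \<Rightarrow> bool" where
  "unital_linear \<Psi> \<longleftrightarrow> Vector_Spaces.linear cscale cscale \<Psi> \<and> \<Psi> (mat 1) = mat 1"

definition KS_operator :: "(complex^'n^'n \<Rightarrow> complex^'n^'n) \<Rightarrow> bool" where
  "KS_operator \<Psi> \<longleftrightarrow> unital_linear \<Psi> \<and> (\<forall>X. adj (\<Psi> X) ** \<Psi> X \<preceq> \<Psi> (adj X ** X))"

definition co_KS_operator :: "(complex^'n^'n \<Rightarrow> complex^'n^'n) \<Rightarrow> bool" where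
  "co_KS_operator \<Psi> \<longleftrightarrow> unital_linear \<Psi> \<and> (\<forall>X. \<Psi> X ** adj (\<Psi> X) \<preceq> \<Psi> (adj X ** X))"

end

theory Submission
  imports Defs
begin

text \<open>
  A KS operator and a co-KS operator both satisfy the Jordan form
  \<open>\<Psi> (X\<^sup>* \<odot> X) \<ge> \<Psi>(X)\<^sup>* \<odot> \<Psi>(X)\<close> of the Schwarz inequality: add the defining inequality
  at \<open>X\<close> to the one at \<open>X\<^sup>*\<close>. The sum has the required shape because \<open>\<Psi>\<close> preserves adjoints
  (\<open>schwarz_imp_adj_preserving\<close>), and the two kinds of operators
  give the same inequality because the Jordan product is symmetric. The inequality for the convex
  combination then follows from the variance identity
  \<open>l A\<^sup>* \<odot> A + (1 - l) B\<^sup>* \<odot> B - C\<^sup>* \<odot> C = l (1 - l) (A - B)\<^sup>* \<odot> (A - B)\<close> with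
  \<open>C = l A + (1 - l) B\<close> (\<open>jordan_variance\<close>), applied to \<open>A = \<Phi>1 x\<close> and \<open>B = \<Phi>2 x\<close>.

  Adjoint preservation holds for every unital linear map that sends each \<open>X\<^sup>* X\<close> to a self-adjoint
  matrix: expanding \<open>X\<^sup>* X\<close> for \<open>X = 1 + x\<close> and \<open>X = 1 + \<i> x\<close> shows that \<open>\<Psi> x + \<Psi> (x\<^sup>*)\<close> and
  \<open>\<i> (\<Psi> x - \<Psi> (x\<^sup>*))\<close> are self-adjoint.
\<close>

lemma adj_adj [simp]: "adj (adj A) = A"
  by (simp add: adj_def vec_eq_iff)

lemma adj_add: "adj (A + B) = adj A + adj B"
  by (simp add: adj_def vec_eq_iff)

lemma adj_diff: "adj (A - B) = adj A - adj B"
  by (simp add: adj_def vec_eq_iff)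

lemma adj_cscale: "adj (cscale c A) = cscale (cnj c) (adj A)"
  by (simp add: adj_def cscale_def vec_eq_iff)

lemma adj_mat_1 [simp]: "adj (mat 1) = mat 1"
  by (auto simp: adj_def mat_def vec_eq_iff)

lemma adj_mult: "adj (A ** B) = adj B ** adj A"
  by (simp add: adj_def matrix_matrix_mult_def vec_eq_iff mult.commute)

lemma cinner_vec_matrix:
  "cinner_vec v (A *v w) = (\<Sum>i\<in>UNIV. \<Sum>j\<in>UNIV. cnj (v $ i) * A $ i $ j * w $ j)"
  by (simp add: cinner_vec_def matrix_vector_mult_def sum_distrib_left mult.assoc)

lemma cinner_vec_adj:
  "cinner_vec v (adj A *v w) = cnj (cinner_vec w (A *v v))"
  unfolding cinner_vec_matrix
  by (subst sum.swap) (simp add: adj_def mult_ac)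

lemma cinner_vec_axis:
  "cinner_vec (axis i 1) (A *v axis j 1) = A $ i $ j"
proof -
  have "cinner_vec (axis i 1) (A *v axis j 1)
      = (\<Sum>k\<in>UNIV. if k = i then (A *v axis j 1) $ k else 0)"
    unfolding cinner_vec_def by (rule sum.cong) (auto simp: axis_def)
  also have "\<dots> = (\<Sum>k\<in>UNIV. if k = j then A $ i $ k else 0)"
    by (simp add: matrix_vector_mult_def axis_def if_distrib cong: if_cong)
  finally show ?thesis
    by simp
qed

text \<open>Polarization: over the complex numbers a quadratic form determines its matrix.\<close>

lemma cinner_vec_quadratic_zero:
  assumes "\<And>v. cinner_vec v (A *v v) = 0"
  shows "A = 0"
proof -
  have "cinner_vec v (A *v w) = 0" for v w
  proof -
    have add: "cinner_vec (v + u) (A *v (v + u)) = cinner_vec v (A *v v) + cinner_vec v (A *v u)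
        + cinner_vec u (A *v v) + cinner_vec u (A *v u)" for u
      by (simp add: cinner_vec_def matrix_vector_right_distrib algebra_simps sum.distrib)
    have 1: "cinner_vec v (A *v w) + cinner_vec w (A *v v) = 0"
      using add[of w] assms by simp
    have "cinner_vec v (A *v (\<i> *s w)) + cinner_vec (\<i> *s w) (A *v v) = 0"
      using add[of "\<i> *s w"] assms by simp
    then have "\<i> * (cinner_vec v (A *v w) - cinner_vec w (A *v v)) = 0"
      by (simp add: cinner_vec_def vector_scalar_commute right_diff_distrib
          sum_distrib_left mult_ac sum_negf)
    with 1 show ?thesis
      by simp
  qed
  then have "A $ i $ j = 0" for i j
    using cinner_vec_axis[of i A j] by simp
  then show ?thesis
    by (simp add: vec_eq_iff)
qed

lemma cinner_vec_matrix_add: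
  "cinner_vec v ((A + B) *v v) = cinner_vec v (A *v v) + cinner_vec v (B *v v)"
  by (simp add: cinner_vec_def matrix_vector_mult_add_rdistrib algebra_simps sum.distrib)

lemma cinner_vec_matrix_diff:
  "cinner_vec v ((A - B) *v v) = cinner_vec v (A *v v) - cinner_vec v (B *v v)"
  using cinner_vec_matrix_add[of v "A - B" B] by simp

lemma psd_imp_self_adjoint:
  assumes "psd A"
  shows "adj A = A"
proof -
  have "cinner_vec v ((adj A - A) *v v) = 0" for v
  proof -
    have "cinner_vec v (A *v v) \<in> \<real>\<^sub>\<ge>\<^sub>0"
      using assms by (simp add: psd_def)
    then show ?thesis
      by (auto simp: cinner_vec_matrix_diff cinner_vec_adj elim: nonneg_Reals_cases)
  qed
  then show ?thesis
    using cinner_vec_quadratic_zero[of "adj A - A"] by simp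
qed

lemma psd_add:
  assumes "psd A" "psd B"
  shows "psd (A + B)"
  using assms by (simp add: psd_def cinner_vec_matrix_add nonneg_Reals_add_I)

lemma psd_scaleR:
  assumes "psd A" "0 \<le> (r::real)"
  shows "psd (r *\<^sub>R A)"
proof -
  have "cinner_vec v ((r *\<^sub>R A) *v v) = of_real r * cinner_vec v (A *v v)" for v
    by (simp add: cinner_vec_matrix sum_distrib_left scaleR_conv_of_real [where 'a = complex] mult_ac)
  then show ?thesis
    using assms by (simp add: psd_def nonneg_Reals_mult_I)
qed

lemma unital_linearD:
  assumes "unital_linear \<Psi>"
  shows "\<Psi> (A + B) = \<Psi> A + \<Psi> B" "\<Psi> (cscale c A) = cscale c (\<Psi> A)"
    "\<Psi> (mat 1) = mat 1"
proof -
  interpret Vector_Spaces.linear cscale cscale \<Psi>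
    using assms by (simp add: unital_linear_def)
  show "\<Psi> (A + B) = \<Psi> A + \<Psi> B" "\<Psi> (cscale c A) = cscale c (\<Psi> A)"
    by (rule add scale)+
  show "\<Psi> (mat 1) = mat 1"
    using assms by (simp add: unital_linear_def)
qed

lemma matrix_add_rdistrib: "(A + B) ** C = A ** C + B ** (C :: complex^'n^'n)"
  by (simp add: matrix_matrix_mult_def vec_eq_iff distrib_right sum.distrib)

lemma schwarz_imp_adj_preserving:
  assumes lin: "unital_linear \<Psi>"
    and sa: "\<And>X. adj (\<Psi> (adj X ** X)) = \<Psi> (adj X ** X)"
  shows "\<Psi> (adj x) = adj (\<Psi> x)"
proof -
  note L = unital_linearD[OF lin]
  \<comment> \<open>The cross terms \<open>c x + (c x)\<^sup>*\<close> of \<open>(1 + c x)\<^sup>* (1 + c x)\<close> are mapped to self-adjoint matrices.\<close>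
  have cross: "adj (cscale c (\<Psi> x) + cscale (cnj c) (\<Psi> (adj x)))
      = cscale c (\<Psi> x) + cscale (cnj c) (\<Psi> (adj x))" for c
  proof -
    let ?y = "cscale c x"
    have "adj (mat 1 + ?y) ** (mat 1 + ?y) = mat 1 + (?y + adj ?y) + adj ?y ** ?y"
      by (simp add: adj_add matrix_add_ldistrib matrix_add_rdistrib add_ac)
    then have "adj (\<Psi> (?y + adj ?y)) = \<Psi> (?y + adj ?y)"
      using sa[of "mat 1 + ?y"] sa[of ?y] by (simp add: L(1,3) adj_add)
    then show ?thesis
      by (simp add: L(1,2) adj_cscale)
  qed
  have "\<Psi> (adj x) $ i $ j = adj (\<Psi> x) $ i $ j" for i j
  proof -
    let ?a = "\<Psi> x" and ?b = "\<Psi> (adj x)"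
    have 1: "cnj (?a $ j $ i) + cnj (?b $ j $ i) = ?a $ i $ j + ?b $ i $ j"
      using cross[of 1] by (simp add: vec_eq_iff adj_def cscale_def)
    have "\<i> * (cnj (?b $ j $ i) - cnj (?a $ j $ i)) = \<i> * (?a $ i $ j - ?b $ i $ j)"
      using cross[of \<i>] by (simp add: vec_eq_iff adj_def cscale_def algebra_simps)
    then have 2: "cnj (?b $ j $ i) - cnj (?a $ j $ i) = ?a $ i $ j - ?b $ i $ j"
      by simp
    have "(cnj (?a $ j $ i) + cnj (?b $ j $ i)) - (cnj (?b $ j $ i) - cnj (?a $ j $ i))
        = (?a $ i $ j + ?b $ i $ j) - (?a $ i $ j - ?b $ i $ j)"
      by (simp only: 1 2)
    then show ?thesis
      by (simp add: adj_def)
  qed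
  then show ?thesis
    by (simp add: vec_eq_iff)
qed

lemma KS_operator_jordan_schwarz:
  assumes "KS_operator \<Psi>"
  shows "adj (\<Psi> x) \<odot> \<Psi> x \<preceq> \<Psi> (adj x \<odot> x)"
proof -
  have lin: "unital_linear \<Psi>"
    and psd: "\<And>X. psd (\<Psi> (adj X ** X) - adj (\<Psi> X) ** \<Psi> X)"
    using assms by (simp_all add: KS_operator_def loewner_le_def)
  have "\<Psi> (adj x) = adj (\<Psi> x)"
    using psd_imp_self_adjoint[OF psd]
    by (intro schwarz_imp_adj_preserving[OF lin]) (simp add: adj_diff adj_mult)
  then have "psd (\<Psi> (x ** adj x) - \<Psi> x ** adj (\<Psi> x))"
    using psd[of "adj x"] by simp
  from psd_add[OF psd[of x] this] show ?thesis
    by (simp add: loewner_le_def jordan_def unital_linearD[OF lin] algebra_simps)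
qed

lemma co_KS_operator_jordan_schwarz:
  assumes "co_KS_operator \<Psi>"
  shows "adj (\<Psi> x) \<odot> \<Psi> x \<preceq> \<Psi> (adj x \<odot> x)"
proof -
  have lin: "unital_linear \<Psi>"
    and psd: "\<And>X. psd (\<Psi> (adj X ** X) - \<Psi> X ** adj (\<Psi> X))"
    using assms by (simp_all add: co_KS_operator_def loewner_le_def)
  have "\<Psi> (adj x) = adj (\<Psi> x)"
    using psd_imp_self_adjoint[OF psd]
    by (intro schwarz_imp_adj_preserving[OF lin]) (simp add: adj_diff adj_mult)
  then have "psd (\<Psi> (x ** adj x) - adj (\<Psi> x) ** \<Psi> x)"
    using psd[of "adj x"] by simp
  from psd_add[OF psd[of x] this] show ?thesis
    by (simp add: loewner_le_def jordan_def unital_linearD[OF lin] algebra_simps)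
qed

lemma jordan_variance:
  fixes A B :: "complex^'n^'n" and l :: real
  defines "C \<equiv> l *\<^sub>R A + (1 - l) *\<^sub>R B"
  shows "l *\<^sub>R (adj A \<odot> A) + (1 - l) *\<^sub>R (adj B \<odot> B) - adj C \<odot> C
    = (l * (1 - l)) *\<^sub>R (adj (A - B) \<odot> (A - B))"
  unfolding vec_eq_iff
proof (intro allI)
  fix i j
  \<comment> \<open>Entrywise both sides are sums over the same index, and the summands agree.\<close>
  show "(l *\<^sub>R (adj A \<odot> A) + (1 - l) *\<^sub>R (adj B \<odot> B) - adj C \<odot> C) $ i $ j
    = ((l * (1 - l)) *\<^sub>R (adj (A - B) \<odot> (A - B))) $ i $ j"
    by (simp add: C_def jordan_def adj_def matrix_matrix_mult_def scaleR_sum_right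
        flip: sum.distrib sum_subtractf)
      (rule sum.cong, simp_all add: scaleR_conv_of_real algebra_simps)
qed

theorem theorem4p1:
  fixes \<Phi> \<Phi>1 \<Phi>2 :: "complex^'n^'n \<Rightarrow> complex^'n^'n"
    and l :: real
  assumes "KS_operator \<Phi>1"
    and "co_KS_operator \<Phi>2"
    and "0 \<le> l" and "l \<le> 1"
    and "\<And>x. \<Phi> x = l *\<^sub>R \<Phi>1 x + (1 - l) *\<^sub>R \<Phi>2 x"
  shows "\<forall>x. (l * (1 - l)) *\<^sub>R (adj (\<Phi>1 x - \<Phi>2 x) \<odot> (\<Phi>1 x - \<Phi>2 x))
      \<preceq> \<Phi> (adj x \<odot> x) - adj (\<Phi> x) \<odot> \<Phi> x"
proof
  fix x
  let ?D1 = "\<Phi>1 (adj x \<odot> x) - adj (\<Phi>1 x) \<odot> \<Phi>1 x"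
  let ?D2 = "\<Phi>2 (adj x \<odot> x) - adj (\<Phi>2 x) \<odot> \<Phi>2 x"
  have "psd ?D1" "psd ?D2"
    using KS_operator_jordan_schwarz[OF assms(1)] co_KS_operator_jordan_schwarz[OF assms(2)]
    by (simp_all add: loewner_le_def)
  then have "psd (l *\<^sub>R ?D1 + (1 - l) *\<^sub>R ?D2)"
    using assms(3,4) by (intro psd_add psd_scaleR) auto
  moreover have "l *\<^sub>R ?D1 + (1 - l) *\<^sub>R ?D2 = \<Phi> (adj x \<odot> x) - adj (\<Phi> x) \<odot> \<Phi> x
      - (l * (1 - l)) *\<^sub>R (adj (\<Phi>1 x - \<Phi>2 x) \<odot> (\<Phi>1 x - \<Phi>2 x))"
    unfolding jordan_variance[symmetric] assms(5) by (simp add: scaleR_diff_right)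
  ultimately show "(l * (1 - l)) *\<^sub>R (adj (\<Phi>1 x - \<Phi>2 x) \<odot> (\<Phi>1 x - \<Phi>2 x))
      \<preceq> \<Phi> (adj x \<odot> x) - adj (\<Phi> x) \<odot> \<Phi> x"
    by (simp add: loewner_le_def)
qed

end
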